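(* Let $G$ be a connected graph with at least three vertices. Then $$\delta(H^*(G,x)) > \frac{1}{MH(G) + 1},\quad \delta(Sc^*(G,x)) > \frac{1}{MS(G) + 1},\quad \delta(Gut^*(G,x)) > \frac{1}{MG(G) + 1},\quad \delta(H_e^*(G,x)) > \frac{1}{MH_e(G) + 1}.$$
   Context: For a connected graph $G$, $d(a,b)$ is the shortest-path distance between vertices, $\deg(a)$ the degree of $a$, and the distance $d(e,f)$ between edges $e,f$ is their distance as vertices of the line graph $L(G)$. For $k\ge1$ let $V_k(G)$ be the set of unordered pairs of vertices at distance $k$ and $E_k(G)$ the set of unordered pairs of edges at distance $k$; set $d_k(G)=|V_k(G)|$, $d_k^e(G)=|E_k(G)|$, $s_k(G)=\sum_{\{a,b\}\in V_k(G)}(\deg(a)+\deg(b))$, $g_k(G)=\sum_{\{a,b\}\in V_k(G)}\deg(a)\deg(b)$ (empty sums are $0$). Define $H(G,x)=\sum_{k\ge1}d_k(G)x^k$, $H_e(G,x)=\sum_{k\ge1}d^e_k(G)x^k$, $Sc(G,x)=\sum_{k\ge1}s_k(G)x^k$, $Gut(G,x)=\sum_{k\ge1}g_k(G)x^k$, and $MH(G)=\max_k d_k(G)$, $MH_e(G)=\max_k d^e_k(G)$, $MS(G)=\max_k s_k(G)$, $MG(G)=\max_k g_k(G)$. Set $H^*=1-H$, $H_e^*=1-H_e$, $Sc^*=1-Sc$, $Gut^*=1-Gut$. Fact (used as known): if $Q(x)=q_1x+\dots+q_mx^m$ with all $q_i\ge 0$ and $\sum q_i\geq 1$, then $Q^*=1-Q$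 has a unique positive root $\delta(Q^* )$, lying in $(0,1]$; this applies to each of $H,H_e,Sc,Gut$ for connected $G$ with at least three vertices. *)

theory Defs
  imports
    "Graph_Theory.Graph_Theory"
    "HOL-Computational_Algebra.Polynomial"
begin

text \<open>
  A finite simple graph is a symmetric digraph satisfying the locale predicate \<^const>\<open>graph\<close>:
  an edge is represented by its two opposite arcs, so the degree of a vertex is its out-degree,
  and the undirected edges are the two-element sets of ends of arcs.
\<close>

definition vertex_dist :: "('a, 'b) pre_digraph \<Rightarrow> 'a \<Rightarrow> 'a \<Rightarrow> ereal" where
  "vertex_dist G a b = wf_digraph.\<mu> G (\<lambda>_. 1) a b"

definition degree_of :: "('a, 'b) pre_digraph \<Rightarrow> 'a \<Rightarrow> nat" where
  "degree_of G v = out_degree G v"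

definition edges_of :: "('a, 'b) pre_digraph \<Rightarrow> 'a set set" where
  "edges_of G = (\<lambda>e. {tail G e, head G e}) ` arcs G"

definition line_graph :: "('a, 'b) pre_digraph \<Rightarrow> ('a set, 'a set \<times> 'a set) pre_digraph" where
  "line_graph G =
    \<lparr> verts = edges_of G,
      arcs = {(e, f). e \<in> edges_of G \<and> f \<in> edges_of G \<and> e \<noteq> f \<and> e \<inter> f \<noteq> {}},
      tail = fst, head = snd \<rparr>"

definition edge_dist :: "('a, 'b) pre_digraph \<Rightarrow> 'a set \<Rightarrow> 'a set \<Rightarrow> ereal" where
  "edge_dist G e f = vertex_dist (line_graph G) e f"

text \<open>
  Unordered pairs are two-element sets; for \<open>k \<ge> 1\<close> the two members below are automatically distinct.
\<close>

definition vertex_pairs :: "('a, 'b) pre_digraph \<Rightarrow> nat \<Rightarrow> 'a set set" where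
  "vertex_pairs G k =
    {{a, b} | a b. a \<in> verts G \<and> b \<in> verts G \<and> vertex_dist G a b = ereal (real k)}"

definition edge_pairs :: "('a, 'b) pre_digraph \<Rightarrow> nat \<Rightarrow> 'a set set set" where
  "edge_pairs G k =
    {{e, f} | e f. e \<in> edges_of G \<and> f \<in> edges_of G \<and> edge_dist G e f = ereal (real k)}"

definition d_num :: "('a, 'b) pre_digraph \<Rightarrow> nat \<Rightarrow> nat" where
  "d_num G k = card (vertex_pairs G k)"

definition de_num :: "('a, 'b) pre_digraph \<Rightarrow> nat \<Rightarrow> nat" where
  "de_num G k = card (edge_pairs G k)"

definition s_num :: "('a, 'b) pre_digraph \<Rightarrow> nat \<Rightarrow> nat" where
  "s_num G k = (\<Sum>p\<in>vertex_pairs G k. \<Sum>v\<in>p. degree_of G v)"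

definition g_num :: "('a, 'b) pre_digraph \<Rightarrow> nat \<Rightarrow> nat" where
  "g_num G k = (\<Sum>p\<in>vertex_pairs G k. \<Prod>v\<in>p. degree_of G v)"

text \<open>
  The polynomial \<open>\<Sum>k\<ge>1. c k * x ^ k\<close> of a sequence with finite support; the sequences above have
  finite support because finite graphs have only finitely many distances.
\<close>

definition gen_poly :: "(nat \<Rightarrow> nat) \<Rightarrow> real poly" where
  "gen_poly c = (\<Sum>k | 1 \<le> k \<and> c k \<noteq> 0. monom (real (c k)) k)"

definition max_coeff :: "(nat \<Rightarrow> nat) \<Rightarrow> nat" where
  "max_coeff c = Max (c ` {1..})"

definition Hosoya :: "('a, 'b) pre_digraph \<Rightarrow> real poly" where
  "Hosoya G = gen_poly (d_num G)"

definition edge_Hosoya :: "('a, 'b) pre_digraph \<Rightarrow> real poly" where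
  "edge_Hosoya G = gen_poly (de_num G)"

definition Schultz :: "('a, 'b) pre_digraph \<Rightarrow> real poly" where
  "Schultz G = gen_poly (s_num G)"

definition Gutman :: "('a, 'b) pre_digraph \<Rightarrow> real poly" where
  "Gutman G = gen_poly (g_num G)"

definition MH :: "('a, 'b) pre_digraph \<Rightarrow> nat" where
  "MH G = max_coeff (d_num G)"

definition MHe :: "('a, 'b) pre_digraph \<Rightarrow> nat" where
  "MHe G = max_coeff (de_num G)"

definition MS :: "('a, 'b) pre_digraph \<Rightarrow> nat" where
  "MS G = max_coeff (s_num G)"

definition MG :: "('a, 'b) pre_digraph \<Rightarrow> nat" where
  "MG G = max_coeff (g_num G)"

definition star :: "real poly \<Rightarrow> real poly" where
  "star Q = 1 - Q"

definition pos_root :: "real poly \<Rightarrow> real" where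
  "pos_root P = (THE x. 0 < x \<and> poly P x = 0)"

end

theory Submission
  imports Defs
begin

text \<open>
  Let \<open>p\<close> be a polynomial without constant term whose coefficients are at most \<open>M\<close>. If \<open>x > 0\<close> and
  \<open>M * x \<le> 1 - x\<close>, then \<open>p x \<le> M * x * (1 + x + \<dots> + x ^ d) \<le> 1 - x ^ (d + 1) < 1\<close>, so every
  positive solution of \<open>p x = 1\<close> exceeds \<open>1 / (M + 1)\<close>. All four polynomials are generating functions
  of the vertex pairs of a graph, weighted and sorted by distance: the edge version counts pairs in
  the line graph. Their positive root exists because some adjacent pair has nonzero weight; for the
  line graph, such a pair is found by leaving first a vertex and then the edge just used.
\<close>

lemma poly_less_1_if_coeff_le:
  fixes p :: "'a::linordered_idom poly"
  assumes "coeff p 0 = 0" and coeff_le: "\<And>i. coeff p i \<le> M"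
    and "0 < x" and M_le: "M * x \<le> 1 - x"
  shows "poly p x < 1"
proof -
  obtain q where p: "p = pCons 0 q"
    using \<open>coeff p 0 = 0\<close> by (cases p) simp
  have "coeff q i \<le> M" for i
    using coeff_le[of "Suc i"] by (simp add: p)
  then have "poly q x \<le> (\<Sum>i\<le>degree q. M * x ^ i)"
    unfolding poly_altdef using \<open>0 < x\<close> by (intro sum_mono mult_right_mono) simp_all
  then have "x * poly q x \<le> x * (\<Sum>i\<le>degree q. M * x ^ i)"
    using \<open>0 < x\<close> by simp
  then have "poly p x \<le> M * x * (\<Sum>i\<le>degree q. x ^ i)"
    by (simp add: p sum_distrib_left mult_ac)
  also have "\<dots> \<le> (1 - x) * (\<Sum>i\<le>degree q. x ^ i)"
    using M_le \<open>0 < x\<close> by (intro mult_right_mono sum_nonneg) simp_all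
  also have "\<dots> = 1 - x ^ Suc (degree q)"
    by (rule sum_gp_basic)
  also have "\<dots> < 1"
    using \<open>0 < x\<close> by simp
  finally show ?thesis .
qed

lemma poly_strict_mono_if_coeff_nonneg:
  fixes p :: "'a::linordered_semidom poly"
  assumes nonneg: "\<And>i. 0 \<le> coeff p i" and "0 < degree p" and "0 \<le> x" "x < y"
  shows "poly p x < poly p y"
  unfolding poly_altdef
proof (rule sum_strict_mono_ex1)
  show "\<forall>i\<in>{..degree p}. coeff p i * x ^ i \<le> coeff p i * y ^ i"
    using nonneg \<open>0 \<le> x\<close> \<open>x < y\<close> by (auto intro!: mult_left_mono power_mono)
  have "lead_coeff p \<noteq> 0"
    using \<open>0 < degree p\<close> by (metis degree_0 leading_coeff_0_iff less_irrefl)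
  then have "0 < lead_coeff p"
    using nonneg[of "degree p"] by (rule order_neq_le_trans[OF not_sym])
  moreover have "x ^ degree p < y ^ degree p"
    using assms by (intro power_strict_mono)
  ultimately show "\<exists>i\<in>{..degree p}. coeff p i * x ^ i < coeff p i * y ^ i"
    by (auto intro: mult_strict_left_mono)
qed simp

lemma coeff_le_poly_1:
  fixes p :: "'a::linordered_semidom poly"
  assumes nonneg: "\<And>i. 0 \<le> coeff p i"
  shows "coeff p j \<le> poly p 1"
proof (cases "j \<le> degree p")
  case True
  then show ?thesis
    using nonneg by (auto simp: poly_altdef intro!: member_le_sum)
next
  case False
  then show ?thesis
    using nonneg by (auto simp: poly_altdef coeff_eq_0 intro!: sum_nonneg)
qed

lemma ex1_pos_root_star:
  assumes nonneg: "\<And>i. 0 \<le> coeff Q i" and "coeff Q 0 = 0" and "1 \<le> poly Q 1"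
  shows "\<exists>!x. 0 < x \<and> poly (star Q) x = 0"
proof (rule ex_ex1I)
  have Q_0: "poly Q 0 = 0"
    using \<open>coeff Q 0 = 0\<close> by (simp add: poly_0_coeff_0)
  then obtain x where "0 \<le> x" "poly Q x = 1"
    using IVT'[of "poly Q" 0 1 1, OF _ _ _ continuous_on_poly[OF continuous_on_id]] \<open>1 \<le> poly Q 1\<close>
    by auto
  moreover from this have "x \<noteq> 0"
    using Q_0 by auto
  ultimately show "\<exists>x. 0 < x \<and> poly (star Q) x = 0"
    by (intro exI[of _ x]) (simp add: star_def)
  have "0 < degree Q"
    using Q_0 \<open>1 \<le> poly Q 1\<close> by (auto elim!: degree_eq_zeroE intro!: gr0I)
  then show "x = y"
    if "0 < x \<and> poly (star Q) x = 0" "0 < y \<and> poly (star Q) y = 0" for x y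
    using that poly_strict_mono_if_coeff_nonneg[of Q x y] poly_strict_mono_if_coeff_nonneg[of Q y x]
      nonneg by (cases x y rule: linorder_cases) (auto simp: star_def)
qed

lemma pos_root_star_gt:
  assumes nonneg: "\<And>i. 0 \<le> coeff Q i" and coeff_0: "coeff Q 0 = 0" and "1 \<le> poly Q 1"
    and coeff_le: "\<And>i. coeff Q i \<le> M"
  shows "1 / (M + 1) < pos_root (star Q)"
proof (rule ccontr)
  assume "\<not> 1 / (M + 1) < pos_root (star Q)"
  moreover have "0 \<le> M"
    using coeff_le[of 0] coeff_0 by simp
  ultimately have "M * pos_root (star Q) \<le> 1 - pos_root (star Q)"
    by (simp add: field_simps)
  moreover have "0 < pos_root (star Q) \<and> poly (star Q) (pos_root (star Q)) = 0"
    unfolding pos_root_def by (rule theI'[OF ex1_pos_root_star[OF assms(1-3)]])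
  ultimately show False
    using poly_less_1_if_coeff_le[OF coeff_0 coeff_le, of "pos_root (star Q)"]
    by (simp add: star_def)
qed

lemma coeff_gen_poly:
  assumes "finite {k. c k \<noteq> 0}"
  shows "coeff (gen_poly c) i = (if i = 0 then 0 else real (c i))"
  using assms by (simp add: gen_poly_def coeff_sum coeff_monom)

lemma le_max_coeff:
  assumes "finite {k. c k \<noteq> 0}" and "1 \<le> k"
  shows "c k \<le> max_coeff c"
proof -
  have "c ` {1..} \<subseteq> insert 0 (c ` {k. c k \<noteq> 0})"
    by auto
  then have "finite (c ` {1..})"
    by (rule finite_subset) (intro finite.insertI finite_imageI assms(1))
  then show ?thesis
    unfolding max_coeff_def using assms(2) by (intro Max_ge) simp_all
qed

lemma pos_root_star_gen_poly_gt:
  assumes fin: "finite {k. c k \<noteq> 0}" and "1 \<le> j" "c j \<noteq> 0"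
  shows "1 / (real (max_coeff c) + 1) < pos_root (star (gen_poly c))"
proof (rule pos_root_star_gt)
  have "1 \<le> coeff (gen_poly c) j"
    using assms by (simp add: coeff_gen_poly)
  also have "\<dots> \<le> poly (gen_poly c) 1"
    by (rule coeff_le_poly_1) (simp add: coeff_gen_poly[OF fin])
  finally show "1 \<le> poly (gen_poly c) 1" .
qed (use fin le_max_coeff[OF fin] in \<open>auto simp: coeff_gen_poly\<close>)

definition pair_weight_sum :: "('a, 'b) pre_digraph \<Rightarrow> ('a set \<Rightarrow> nat) \<Rightarrow> nat \<Rightarrow> nat" where
  "pair_weight_sum G w k = (\<Sum>p\<in>vertex_pairs G k. w p)"

lemma d_num_eq_pair_weight_sum: "d_num G = pair_weight_sum G (\<lambda>_. 1)"
  by (simp add: fun_eq_iff d_num_def pair_weight_sum_def)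

lemma s_num_eq_pair_weight_sum: "s_num G = pair_weight_sum G (sum (degree_of G))"
  by (simp add: fun_eq_iff s_num_def pair_weight_sum_def)

lemma g_num_eq_pair_weight_sum: "g_num G = pair_weight_sum G (prod (degree_of G))"
  by (simp add: fun_eq_iff g_num_def pair_weight_sum_def)

lemma edge_pairs_eq_vertex_pairs_line_graph: "edge_pairs G = vertex_pairs (line_graph G)"
  by (simp add: fun_eq_iff edge_pairs_def vertex_pairs_def edge_dist_def line_graph_def)

lemma de_num_eq_pair_weight_sum: "de_num G = pair_weight_sum (line_graph G) (\<lambda>_. 1)"
  by (simp add: fun_eq_iff de_num_def pair_weight_sum_def edge_pairs_eq_vertex_pairs_line_graph)

lemma finite_vertex_pairs: "finite (verts G) \<Longrightarrow> finite (vertex_pairs G k)"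
  by (rule finite_subset[of _ "Pow (verts G)"]) (auto simp: vertex_pairs_def)

lemma finite_distances:
  assumes "finite (verts G)"
  shows "finite {k. vertex_pairs G k \<noteq> {}}"
proof (rule finite_subset)
  let ?D = "(\<lambda>(a, b). vertex_dist G a b) ` (verts G \<times> verts G)"
  show "{k. vertex_pairs G k \<noteq> {}} \<subseteq> (\<lambda>k. ereal (real k)) -` ?D"
    by (force simp: vertex_pairs_def)
  show "finite ((\<lambda>k. ereal (real k)) -` ?D)"
    using assms by (intro finite_vimageI) (auto simp: inj_on_def)
qed

lemma finite_pair_weight_sum_support:
  assumes "finite (verts G)"
  shows "finite {k. pair_weight_sum G w k \<noteq> 0}"
  using finite_distances[OF assms]
  by (rule rev_finite_subset) (auto simp: pair_weight_sum_def)

lemma (in wf_digraph) vertex_dist_adj: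
  assumes "u \<rightarrow>\<^bsub>G\<^esub> v" and "u \<noteq> v"
  shows "vertex_dist G u v = 1"
  unfolding vertex_dist_def
proof (rule antisym)
  obtain e where "awalk u [e] v"
    using \<open>u \<rightarrow>\<^bsub>G\<^esub> v\<close> by (auto dest: arc_implies_awalk)
  then show "\<mu> (\<lambda>_. 1) u v \<le> 1"
    using min_cost_le_walk_cost[of u "[e]" v "\<lambda>_. 1"] by (simp add: one_ereal_def)
  show "1 \<le> \<mu> (\<lambda>_. 1) u v"
    unfolding \<mu>_def
  proof (rule INF_greatest)
    fix p assume "p \<in> {p. awalk u p v}"
    then obtain e q where "p = e # q"
      using \<open>u \<noteq> v\<close> by (cases p) (auto simp: awalk_Nil_iff)
    then show "1 \<le> ereal (awalk_cost (\<lambda>_. 1) p)"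
      by (simp add: awalk_cost_def sum_list_triv one_ereal_def)
  qed
qed

lemma (in wf_digraph) adj_in_vertex_pairs_1:
  assumes "u \<rightarrow>\<^bsub>G\<^esub> v" and "u \<noteq> v"
  shows "{u, v} \<in> vertex_pairs G 1"
  using vertex_dist_adj[OF assms] adj_in_verts[OF assms(1)]
  by (auto simp: vertex_pairs_def one_ereal_def)

lemma (in wf_digraph) pos_root_star_pair_weight_sum_gt:
  assumes fin: "finite (verts G)" and adj: "u \<rightarrow>\<^bsub>G\<^esub> v" "u \<noteq> v" and weight: "w {u, v} \<noteq> 0"
  shows "1 / (real (max_coeff (pair_weight_sum G w)) + 1)
    < pos_root (star (gen_poly (pair_weight_sum G w)))"
proof (rule pos_root_star_gen_poly_gt[OF finite_pair_weight_sum_support[OF fin]])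
  show "pair_weight_sum G w 1 \<noteq> 0"
    using adj_in_vertex_pairs_1[OF adj] finite_vertex_pairs[OF fin] weight
    by (auto simp: pair_weight_sum_def)
qed simp

lemma edges_of_conv_adj: "edges_of G = {{u, v} | u v. u \<rightarrow>\<^bsub>G\<^esub> v}"
  by (auto simp: edges_of_def arcs_ends_conv)

lemma adj_line_graph_iff:
  "e \<rightarrow>\<^bsub>line_graph G\<^esub> f \<longleftrightarrow> e \<in> edges_of G \<and> f \<in> edges_of G \<and> e \<noteq> f \<and> e \<inter> f \<noteq> {}"
  by (force simp: line_graph_def arcs_ends_conv)

lemma wf_digraph_line_graph: "wf_digraph (line_graph G)"
  by unfold_locales (auto simp: line_graph_def)

lemma (in fin_digraph) finite_verts_line_graph: "finite (verts (line_graph G))"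
  by (simp add: line_graph_def edges_of_def)

lemma (in fin_digraph) degree_of_pos:
  assumes "u \<rightarrow>\<^bsub>G\<^esub> v"
  shows "0 < degree_of G u"
  using assms by (auto simp: degree_of_def out_degree_def card_gt_0_iff arcs_ends_conv)

lemma (in wf_digraph) strongly_connected_obtain_leaving_adj:
  assumes "strongly_connected G" and "S \<noteq> {}" "S \<subset> verts G"
  obtains u v where "u \<in> S" "v \<notin> S" "u \<rightarrow>\<^bsub>G\<^esub> v"
proof -
  obtain a b where "a \<in> S" "b \<in> verts G" "b \<notin> S"
    using assms(2,3) by blast
  then have "a \<rightarrow>\<^sup>*\<^bsub>G\<^esub> b"
    using assms(1,3) by blast
  then have "\<exists>u v. u \<in> S \<and> v \<notin> S \<and> u \<rightarrow>\<^bsub>G\<^esub> v"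
    using \<open>b \<notin> S\<close>
  proof (induction rule: reachable_induct)
    case base
    then show ?case using \<open>a \<in> S\<close> by simp
  next
    case (step x y)
    then show ?case by blast
  qed
  then show ?thesis using that by blast
qed

lemma (in wf_digraph) strongly_connected_obtain_adj_line_graph:
  assumes sc: "strongly_connected G" and card: "3 \<le> card (verts G)"
  obtains e f where "e \<rightarrow>\<^bsub>line_graph G\<^esub> f"
proof -
  have proper: "S \<subset> verts G" if "S \<subseteq> verts G" "card S \<le> 2" for S
    using that card by (auto simp: psubset_eq)
  obtain u where "u \<in> verts G"
    using card by fastforce
  then have "{u} \<subset> verts G"
    by (intro proper) simp_all
  then obtain u' v where "u' \<in> {u}" "v \<notin> {u}" "u' \<rightarrow>\<^bsub>G\<^esub> v"
    by (rule strongly_connected_obtain_leaving_adj[OF sc insert_not_empty])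
  then have v: "v \<noteq> u" "u \<rightarrow>\<^bsub>G\<^esub> v"
    by simp_all
  have "{u, v} \<subset> verts G"
    using adj_in_verts[OF v(2)] by (intro proper) (simp_all add: card_insert_if)
  then obtain x y where xy: "x \<in> {u, v}" "y \<notin> {u, v}" "x \<rightarrow>\<^bsub>G\<^esub> y"
    by (rule strongly_connected_obtain_leaving_adj[OF sc insert_not_empty])
  have "{u, v} \<rightarrow>\<^bsub>line_graph G\<^esub> {x, y}"
    using v xy by (auto simp: adj_line_graph_iff edges_of_conv_adj)
  then show ?thesis by (rule that)
qed

theorem theorem8:
  fixes G :: "('a, 'b) pre_digraph"
  assumes "graph G"
    and "Digraph_Component.connected G"
    and "card (verts G) \<ge> 3"
  shows "pos_root (star (Hosoya G)) > 1 / (real (MH G) + 1)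
    \<and> pos_root (star (Schultz G)) > 1 / (real (MS G) + 1)
    \<and> pos_root (star (Gutman G)) > 1 / (real (MG G) + 1)
    \<and> pos_root (star (edge_Hosoya G)) > 1 / (real (MHe G) + 1)"
proof -
  interpret graph G by fact
  interpret L: wf_digraph "line_graph G" by (rule wf_digraph_line_graph)
  have "strongly_connected G"
    using symmetric_connected_imp_strongly_connected[OF sym_arcs assms(2)] .
  then obtain e f where ef: "e \<rightarrow>\<^bsub>line_graph G\<^esub> f"
    using strongly_connected_obtain_adj_line_graph[OF _ assms(3)] by blast
  then obtain u v where adj: "u \<rightarrow>\<^bsub>G\<^esub> v"
    by (auto simp: adj_line_graph_iff edges_of_conv_adj)
  have "u \<noteq> v" and "e \<noteq> f"
    using adj adj_not_same ef adj_line_graph_iff by blast+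
  have "0 < degree_of G u" and "0 < degree_of G v"
    using degree_of_pos adj arcs_ends_symmetric[OF sym_arcs adj] by auto
  then show ?thesis
    unfolding Hosoya_def Schultz_def Gutman_def edge_Hosoya_def MH_def MS_def MG_def MHe_def
      d_num_eq_pair_weight_sum s_num_eq_pair_weight_sum g_num_eq_pair_weight_sum
      de_num_eq_pair_weight_sum
    using pos_root_star_pair_weight_sum_gt[OF finite_verts adj \<open>u \<noteq> v\<close>]
      L.pos_root_star_pair_weight_sum_gt[OF finite_verts_line_graph ef \<open>e \<noteq> f\<close>]
      \<open>u \<noteq> v\<close> by simp
qed

end
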